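(* Let $G$ be an additive abelian group. Let $h$ and $m$ be positive integers with $m\geq 2$. Then: (1) $\rho_{\pm}(G, m, [0, h]) = \min \{|[0, h]_{\pm}A| : A \in \mathrm{Sym}(G, m)\}$. (2) $\rho_{\pm}(G, m, [0, h]) = \min \{|h(A \cup \{0\})| : A \in \mathrm{Sym}(G, m)\}$. (3) If $m$ is odd, then $\rho_{\pm}(G, m, [0, h]) = \min \{|hA|: A \in \mathrm{Sym}(G, m),\ 0 \in A\}$. (4) If $G$ is finite and its order $n=|G|$ is odd, then $\rho_{\pm}(G, m, [0, h]) = \min \{|hA|: A \in \mathrm{Sym}(G, 2 \lfloor m / 2 \rfloor + 1),\ 0 \in A\}$.
   Context: For a nonempty finite subset $A=\{a_1,\dots,a_k\}$ (with $|A|=k$) of an additive abelian group $G$ and a nonnegative integer $h$, the $h$-fold sumset is $hA=\{\sum_{i=1}^k\lambda_i a_i:\lambda_i\in\mathbb{Z}\cap[0,h],\ \sum_{i=1}^k\lambda_i=h\}$ and the $h$-fold signed sumset is $h_{\pm}A=\{\sum_{i=1}^k\lambda_i a_i:\lambda_i\in\mathbb{Z}\cap[-h,h],\ \sum_{i=1}^k|\lambda_i|=h\}$, with $0A=0_{\pm}A=\{0\}$. With $[0,h]=\{0,1,\dots,h\}$, put $[0,h]_{\pm}A=\bigcup_{j=0}^{h}j_{\pm}A$. Define $\rho_{\pm}(G,m,[0,h])=\min\{|[0,h]_{\pm}A|:A\subseteq G,\ |A|=m\}$ and $\mathrm{Sym}(G,m)=\{A\subseteq G:A=-A,\ |A|=m\}$,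 where $-A=\{-a:a\in A\}$. Minima are understood to be over nonempty families, i.e. $G$ has at least $m$ elements. *)

theory Defs
  imports "HOL-Algebra.Ring"
begin

text \<open>
  An additive abelian group is a structure \<open>G\<close> with \<open>abelian_group G\<close>; only the additive part
  of the ring record is used.
\<close>

definition sumset :: "('a, 'b) ring_scheme \<Rightarrow> nat \<Rightarrow> 'a set \<Rightarrow> 'a set" where
  "sumset G h A =
    {(\<Oplus>\<^bsub>G\<^esub>a\<in>A. [c a] \<cdot>\<^bsub>G\<^esub> a) | c :: 'a \<Rightarrow> int.
       (\<forall>a\<in>A. c a \<in> {0..int h}) \<and> (\<Sum>a\<in>A. c a) = int h}"

definition signed_sumset :: "('a, 'b) ring_scheme \<Rightarrow> nat \<Rightarrow> 'a set \<Rightarrow> 'a set" where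
  "signed_sumset G h A =
    {(\<Oplus>\<^bsub>G\<^esub>a\<in>A. [c a] \<cdot>\<^bsub>G\<^esub> a) | c :: 'a \<Rightarrow> int.
       (\<forall>a\<in>A. c a \<in> {- int h..int h}) \<and> (\<Sum>a\<in>A. \<bar>c a\<bar>) = int h}"

definition signed_sumset_upto :: "('a, 'b) ring_scheme \<Rightarrow> nat \<Rightarrow> 'a set \<Rightarrow> 'a set" where
  "signed_sumset_upto G h A = (\<Union>j\<in>{0..h}. signed_sumset G j A)"

text \<open>
  Minima of sets of natural numbers are written with \<open>INF\<close>: on type \<open>nat\<close>, the infimum of a
  nonempty set is its least element (and, unlike \<open>Min\<close>, no finiteness is needed a priori).
\<close>

definition rho_signed_upto :: "('a, 'b) ring_scheme \<Rightarrow> nat \<Rightarrow> nat \<Rightarrow> nat" where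
  "rho_signed_upto G m h =
    (INF A\<in>{A. A \<subseteq> carrier G \<and> card A = m}. card (signed_sumset_upto G h A))"

definition Sym :: "('a, 'b) ring_scheme \<Rightarrow> nat \<Rightarrow> 'a set set" where
  "Sym G m = {A. A \<subseteq> carrier G \<and> A = a_inv G ` A \<and> card A = m}"

end

theory Submission
  imports Defs "HOL-Algebra.Multiplicative_Group"
begin

text \<open>
  Everything rests on the identity \<open>[0,h]\<^sub>\<plusminus>A = h(A \<union> -A \<union> {0})\<close>: both sides consist of the
  elements reachable from \<open>0\<close> in \<open>h\<close> steps, each of which adds an element of \<open>A\<close>, subtracts
  one, or stays put. This is \<open>signed_sumset_upto_eq_sumset\<close>, proved by showing that both sides
  satisfy the same recursion in \<open>h\<close>.

  Given any \<open>A\<close> with \<open>m\<close> elements, the set \<open>B = A \<union> -A \<union> {0}\<close> is symmetric, contains \<open>0\<close> and has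
  at least \<open>m\<close> elements. A symmetric \<open>A' \<subseteq> B\<close> has \<open>A' \<union> -A' \<union> {0} \<subseteq> B\<close>, so that
  \<open>[0,h]\<^sub>\<plusminus>A' \<subseteq> hB = [0,h]\<^sub>\<plusminus>A\<close>. It remains to find inside \<open>B\<close> a symmetric set of the prescribed
  size. For odd sizes one starts from \<open>{0}\<close> and keeps adding two elements, either a pair
  \<open>{x, -x}\<close> or two elements equal to their own negatives
  (\<open>odd_symmetric_subset_exists\<close>); for an even size one adds a last self-negative element, or
  trades \<open>0\<close> for a pair \<open>{x, -x}\<close> (\<open>symmetric_subset_exists\<close>). If the group has odd order, no
  nonzero element is its own negative, so a \<open>B\<close> with at least \<open>m\<close> elements, \<open>m\<close> even, has at
  least \<open>m + 1\<close> of them and even contains a symmetric set of size \<open>m + 1\<close> through \<open>0\<close>.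

  The opposite inequalities are immediate, since symmetric sets of size \<open>m\<close> compete in the
  minimum over all sets; a symmetric set of size \<open>m + 1\<close> through \<open>0\<close> competes after \<open>0\<close> is
  removed from it, which does not change \<open>[0,h]\<^sub>\<plusminus>A\<close>.
\<close>

context abelian_group
begin

section \<open>Sumsets as iterated addition\<close>

lemma add_int_pow_minus_1: "a \<in> carrier G \<Longrightarrow> [(-1::int)] \<cdot> a = \<ominus> a"
  using group.int_pow_neg[OF a_group, of a 1] group.int_pow_1[OF a_group, of a]
  by (simp add: add_pow_def a_inv_def)

lemma finsum_int_pow_closed:
  "A \<subseteq> carrier G \<Longrightarrow> (\<Oplus>a\<in>A. [(c a::int)] \<cdot> a) \<in> carrier G"
  by (intro finsum_closed) (auto intro: add.int_pow_closed)

lemma finsum_int_pow_zero: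
  assumes "\<forall>a\<in>A. c a = (0::int)"
  shows "(\<Oplus>a\<in>A. [c a] \<cdot> a) = \<zero>"
proof -
  have "(\<Oplus>a\<in>A. [c a] \<cdot> a) = (\<Oplus>a\<in>A. \<zero>)"
    using assms by (intro finsum_cong') (auto simp: add_pow_def)
  then show ?thesis by (simp add: finsum_zero)
qed

lemma finsum_int_pow_update:
  assumes A: "finite A" "A \<subseteq> carrier G" "b \<in> A"
  shows "(\<Oplus>a\<in>A. [((c(b := c b + k)) a)] \<cdot> a) = (\<Oplus>a\<in>A. [c a] \<cdot> a) \<oplus> [(k::int)] \<cdot> b"
proof -
  define S where "S = (\<Oplus>a\<in>A - {b}. [c a] \<cdot> a)"
  have b: "b \<in> carrier G" using A by auto
  have S: "S \<in> carrier G" unfolding S_def using A by (intro finsum_int_pow_closed) auto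
  have ins: "(\<Oplus>a\<in>insert b (A - {b}). [d a] \<cdot> a) = [d b] \<cdot> b \<oplus> (\<Oplus>a\<in>A - {b}. [d a] \<cdot> a)"
    for d :: "'a \<Rightarrow> int"
    using A b by (intro finsum_insert) (auto intro: add.int_pow_closed)
  have rest: "(\<Oplus>a\<in>A - {b}. [((c(b := c b + k)) a)] \<cdot> a) = S"
    unfolding S_def using A by (intro finsum_cong') (auto intro: add.int_pow_closed)
  have split: "insert b (A - {b}) = A" using A by auto
  have "(\<Oplus>a\<in>A. [((c(b := c b + k)) a)] \<cdot> a) = [(c b + k)] \<cdot> b \<oplus> S"
    using ins[of "c(b := c b + k)"] unfolding rest split by simp
  also have "\<dots> = ([c b] \<cdot> b \<oplus> S) \<oplus> [k] \<cdot> b"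
    using b S by (simp add: add.int_pow_mult add.int_pow_closed a_ac)
  also have "[c b] \<cdot> b \<oplus> S = (\<Oplus>a\<in>A. [c a] \<cdot> a)"
    using ins[of c] unfolding split S_def by simp
  finally show ?thesis .
qed

text \<open>
  The upper bounds on the coefficients follow from the prescribed sum and can be dropped; the
  remaining conditions are easy to maintain when one coefficient changes by one.
\<close>

lemma sumset_altdef:
  assumes "finite A"
  shows "sumset G h A =
    {(\<Oplus>a\<in>A. [c a] \<cdot> a) | c. (\<forall>a\<in>A. 0 \<le> c a) \<and> (\<Sum>a\<in>A. c a) = int h}"
proof -
  have "c b \<le> int h" if "\<forall>a\<in>A. 0 \<le> c a" "(\<Sum>a\<in>A. c a) = int h" "b \<in> A" for c b
    using member_le_sum[of b A c] that assms by auto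
  then show ?thesis unfolding sumset_def by auto
qed

lemma signed_sumset_upto_altdef:
  assumes "finite A"
  shows "signed_sumset_upto G h A = {(\<Oplus>a\<in>A. [c a] \<cdot> a) | c. (\<Sum>a\<in>A. \<bar>c a\<bar>) \<le> int h}"
    (is "_ = ?R")
proof
  show "signed_sumset_upto G h A \<subseteq> ?R"
    unfolding signed_sumset_upto_def signed_sumset_def by fastforce
  show "?R \<subseteq> signed_sumset_upto G h A"
  proof
    fix x assume "x \<in> ?R"
    then obtain c where x: "x = (\<Oplus>a\<in>A. [c a] \<cdot> a)" and le: "(\<Sum>a\<in>A. \<bar>c a\<bar>) \<le> int h"
      by auto
    define j where "j = nat (\<Sum>a\<in>A. \<bar>c a\<bar>)"
    have j: "(\<Sum>a\<in>A. \<bar>c a\<bar>) = int j" unfolding j_def by (simp add: sum_nonneg)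
    have "\<bar>c b\<bar> \<le> int j" if "b \<in> A" for b
      using member_le_sum[of b A "\<lambda>a. \<bar>c a\<bar>"] that assms j by auto
    then have "x \<in> signed_sumset G j A"
      unfolding signed_sumset_def x using j by (fastforce simp: abs_le_iff)
    moreover have "j \<le> h" using le j by simp
    ultimately show "x \<in> signed_sumset_upto G h A" unfolding signed_sumset_upto_def by auto
  qed
qed

lemma sumset_0:
  assumes "finite A" "A \<subseteq> carrier G"
  shows "sumset G 0 A = {\<zero>}"
proof -
  have "(\<forall>a\<in>A. 0 \<le> c a) \<and> (\<Sum>a\<in>A. c a) = int 0 \<longleftrightarrow> (\<forall>a\<in>A. c a = 0)" for c :: "'a \<Rightarrow> int"
    using sum_nonneg_eq_0_iff[OF assms(1), of c] by auto
  then show ?thesis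
    unfolding sumset_altdef[OF assms(1)]
    by (auto simp: finsum_int_pow_zero intro!: exI[of _ "\<lambda>_. 0"])
qed

lemma signed_sumset_upto_0:
  assumes "finite A" "A \<subseteq> carrier G"
  shows "signed_sumset_upto G 0 A = {\<zero>}"
proof -
  have "(\<Sum>a\<in>A. \<bar>c a\<bar>) \<le> int 0 \<longleftrightarrow> (\<forall>a\<in>A. c a = 0)" for c :: "'a \<Rightarrow> int"
  proof -
    have "(\<Sum>a\<in>A. \<bar>c a\<bar>) \<ge> 0" by (simp add: sum_nonneg)
    then have "(\<Sum>a\<in>A. \<bar>c a\<bar>) \<le> int 0 \<longleftrightarrow> (\<Sum>a\<in>A. \<bar>c a\<bar>) = 0" by linarith
    also have "\<dots> \<longleftrightarrow> (\<forall>a\<in>A. c a = 0)" using assms(1) by (simp add: sum_nonneg_eq_0_iff)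
    finally show ?thesis .
  qed
  then show ?thesis
    unfolding signed_sumset_upto_altdef[OF assms(1)]
    by (auto simp: finsum_int_pow_zero intro!: exI[of _ "\<lambda>_. 0"])
qed

text \<open>
  The coefficients of an element of \<open>(h + 1)A\<close> have positive sum, so one of them is positive and
  can be lowered by one.
\<close>

lemma sumset_Suc:
  assumes A: "finite A" "A \<subseteq> carrier G"
  shows "sumset G (Suc h) A = {x \<oplus> b | x b. x \<in> sumset G h A \<and> b \<in> A}" (is "_ = ?R")
proof
  show "sumset G (Suc h) A \<subseteq> ?R"
  proof
    fix y assume "y \<in> sumset G (Suc h) A"
    then obtain c where y: "y = (\<Oplus>a\<in>A. [c a] \<cdot> a)"
      and c: "\<forall>a\<in>A. 0 \<le> c a" "(\<Sum>a\<in>A. c a) = int (Suc h)"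
      unfolding sumset_altdef[OF A(1)] by auto
    have "\<exists>b\<in>A. c b \<noteq> 0"
      using c(2) sum.neutral[of A c] by fastforce
    then obtain b where b: "b \<in> A" "c b > 0" using c(1) by force
    define d where "d = c(b := c b + (-1))"
    have dc: "c = d(b := d b + 1)" unfolding d_def by auto
    have "y = (\<Oplus>a\<in>A. [d a] \<cdot> a) \<oplus> b"
      unfolding y by (subst dc, subst finsum_int_pow_update) (use A b in \<open>auto simp: add.int_pow_1\<close>)
    moreover have "(\<Sum>a\<in>A. d a) = int h"
      using c(2) b A(1) unfolding d_def by (simp add: sum.remove)
    moreover have "\<forall>a\<in>A. 0 \<le> d a" unfolding d_def using c b by auto
    ultimately show "y \<in> ?R" unfolding sumset_altdef[OF A(1)] using b by blast
  qed
  show "?R \<subseteq> sumset G (Suc h) A"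
  proof
    fix y assume "y \<in> ?R"
    then obtain c b where b: "b \<in> A" and y: "y = (\<Oplus>a\<in>A. [c a] \<cdot> a) \<oplus> b"
      and c: "\<forall>a\<in>A. 0 \<le> c a" "(\<Sum>a\<in>A. c a) = int h"
      unfolding sumset_altdef[OF A(1)] by auto
    define d where "d = c(b := c b + 1)"
    have "y = (\<Oplus>a\<in>A. [d a] \<cdot> a)"
      unfolding y d_def by (subst finsum_int_pow_update) (use A b in \<open>auto simp: add.int_pow_1\<close>)
    moreover have "(\<Sum>a\<in>A. d a) = int (Suc h)"
      using c(2) b A(1) unfolding d_def by (simp add: sum.remove)
    moreover have "\<forall>a\<in>A. 0 \<le> d a" unfolding d_def using c b by auto
    ultimately show "y \<in> sumset G (Suc h) A" unfolding sumset_altdef[OF A(1)] by blast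
  qed
qed

text \<open>
  Moving a nonzero coefficient one step towards \<open>0\<close> splits off \<open>a\<close> or \<open>-a\<close> and lowers the total
  absolute value by one; conversely, adding \<open>a\<close> or \<open>-a\<close> raises that total by at most one. The
  summand \<open>0\<close> serves elements whose coefficients have total at most \<open>h\<close> already.
\<close>

lemma signed_sumset_upto_Suc:
  assumes A: "finite A" "A \<subseteq> carrier G"
  shows "signed_sumset_upto G (Suc h) A =
    {x \<oplus> b | x b. x \<in> signed_sumset_upto G h A \<and> b \<in> A \<union> a_inv G ` A \<union> {\<zero>}}" (is "_ = ?R")
proof
  have Suc: "\<exists>b\<in>A \<union> a_inv G ` A. [k] \<cdot> a = b" if "a \<in> A" "k = 1 \<or> k = -1" for a and k :: int
    using that A by (auto simp: add.int_pow_1 add_int_pow_minus_1)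
  show "signed_sumset_upto G (Suc h) A \<subseteq> ?R"
  proof
    fix y assume "y \<in> signed_sumset_upto G (Suc h) A"
    then obtain c where y: "y = (\<Oplus>a\<in>A. [c a] \<cdot> a)"
      and c: "(\<Sum>a\<in>A. \<bar>c a\<bar>) \<le> int (Suc h)"
      unfolding signed_sumset_upto_altdef[OF A(1)] by auto
    show "y \<in> ?R"
    proof (cases "(\<Sum>a\<in>A. \<bar>c a\<bar>) \<le> int h")
      case True
      then have "y \<in> signed_sumset_upto G h A"
        unfolding signed_sumset_upto_altdef[OF A(1)] y by blast
      moreover have "y = y \<oplus> \<zero>" unfolding y using A by (simp add: finsum_int_pow_closed)
      ultimately show ?thesis by blast
    next
      case False
      then have "\<exists>b\<in>A. c b \<noteq> 0"
        using sum.neutral[of A "\<lambda>a. \<bar>c a\<bar>"] by fastforce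
      then obtain b where b: "b \<in> A" "c b \<noteq> 0" by auto
      define d where "d = c(b := c b + (- sgn (c b)))"
      have dc: "c = d(b := d b + sgn (c b))" unfolding d_def by auto
      have "y = (\<Oplus>a\<in>A. [d a] \<cdot> a) \<oplus> [(sgn (c b))] \<cdot> b"
        unfolding y by (subst dc, subst finsum_int_pow_update) (use A b in auto)
      moreover have "\<bar>d b\<bar> = \<bar>c b\<bar> - 1" unfolding d_def using b by (auto simp: sgn_if)
      then have "(\<Sum>a\<in>A. \<bar>d a\<bar>) \<le> int h"
        using c b A(1) unfolding d_def by (simp add: sum.remove)
      moreover have "sgn (c b) = 1 \<or> sgn (c b) = -1" using b by (auto simp: sgn_if)
      then obtain b' where "b' \<in> A \<union> a_inv G ` A" "[(sgn (c b))] \<cdot> b = b'"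
        using Suc[OF b(1)] by blast
      ultimately show ?thesis
        unfolding signed_sumset_upto_altdef[OF A(1)] by blast
    qed
  qed
  show "?R \<subseteq> signed_sumset_upto G (Suc h) A"
  proof
    fix y assume "y \<in> ?R"
    then obtain c b' where b': "b' \<in> A \<union> a_inv G ` A \<union> {\<zero>}" and y: "y = (\<Oplus>a\<in>A. [c a] \<cdot> a) \<oplus> b'"
      and c: "(\<Sum>a\<in>A. \<bar>c a\<bar>) \<le> int h"
      unfolding signed_sumset_upto_altdef[OF A(1)] by auto
    show "y \<in> signed_sumset_upto G (Suc h) A"
    proof (cases "b' = \<zero>")
      case True
      then have "y = (\<Oplus>a\<in>A. [c a] \<cdot> a)" using y A by (simp add: finsum_int_pow_closed)
      then show ?thesis unfolding signed_sumset_upto_altdef[OF A(1)] using c by force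
    next
      case False
      then have "b' \<in> A \<or> (\<exists>b\<in>A. b' = \<ominus> b)" using b' by auto
      then obtain b k where b: "b \<in> A" "b' = [k] \<cdot> b" "k = 1 \<or> k = (-1::int)"
        using A by (metis add.int_pow_1 add_int_pow_minus_1 subsetD)
      define d where "d = c(b := c b + k)"
      have "y = (\<Oplus>a\<in>A. [d a] \<cdot> a)"
        unfolding y d_def b(2) using finsum_int_pow_update[OF A b(1)] by simp
      moreover have "\<bar>d b\<bar> \<le> \<bar>c b\<bar> + 1" unfolding d_def using b by auto
      then have "(\<Sum>a\<in>A. \<bar>d a\<bar>) \<le> int (Suc h)"
        using c b A(1) unfolding d_def by (simp add: sum.remove)
      ultimately show ?thesis unfolding signed_sumset_upto_altdef[OF A(1)] by blast
    qed
  qed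
qed

text \<open>
  On the right \<open>a\<close> and \<open>-a\<close> carry separate coefficients unless they coincide, whereas on the
  left each \<open>a \<in> A\<close> has one signed coefficient, and \<open>A\<close> itself may contain opposite elements. A
  direct translation of coefficients would need a case distinction; the common recursion does not.
\<close>

theorem signed_sumset_upto_eq_sumset:
  assumes A: "finite A" "A \<subseteq> carrier G"
  shows "signed_sumset_upto G h A = sumset G h (A \<union> a_inv G ` A \<union> {\<zero>})"
proof -
  have B: "finite (A \<union> a_inv G ` A \<union> {\<zero>})" "A \<union> a_inv G ` A \<union> {\<zero>} \<subseteq> carrier G"
    using A by auto
  show ?thesis
  proof (induction h)
    case 0
    show ?case unfolding signed_sumset_upto_0[OF A] sumset_0[OF B] ..
  next
    case (Suc h)
    show ?case unfolding signed_sumset_upto_Suc[OF A] sumset_Suc[OF B] Suc ..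
  qed
qed

lemma finite_sumset:
  assumes "finite A" "A \<subseteq> carrier G"
  shows "finite (sumset G h A)"
proof (induction h)
  case (Suc h)
  have "sumset G (Suc h) A = (\<lambda>(x, b). x \<oplus> b) ` (sumset G h A \<times> A)"
    unfolding sumset_Suc[OF assms] by auto
  then show ?case using Suc assms by simp
qed (simp add: sumset_0 assms)

lemma sumset_mono:
  assumes "finite B" "A \<subseteq> B" "B \<subseteq> carrier G"
  shows "sumset G h A \<subseteq> sumset G h B"
proof -
  have A: "finite A" "A \<subseteq> carrier G"
    using finite_subset[OF assms(2,1)] assms(2,3) by simp_all
  show ?thesis
  proof (induction h)
    case 0
    show ?case unfolding sumset_0[OF A] sumset_0[OF assms(1,3)] ..
  next
    case (Suc h)
    then show ?case unfolding sumset_Suc[OF A] sumset_Suc[OF assms(1,3)] using assms(2) by blast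
  qed
qed

section \<open>Symmetric subsets of prescribed size\<close>

lemma symmetric_iff:
  assumes "A \<subseteq> carrier G"
  shows "A = a_inv G ` A \<longleftrightarrow> (\<forall>x\<in>A. \<ominus> x \<in> A)"
proof
  assume r: "\<forall>x\<in>A. \<ominus> x \<in> A"
  show "A = a_inv G ` A"
  proof
    show "A \<subseteq> a_inv G ` A"
    proof
      fix x assume "x \<in> A"
      then show "x \<in> a_inv G ` A" using r assms by (intro image_eqI[of _ _ "\<ominus> x"]) auto
    qed
  qed (use r in auto)
qed blast

lemma Sym_iff: "A \<in> Sym G m \<longleftrightarrow> A \<subseteq> carrier G \<and> (\<forall>x\<in>A. \<ominus> x \<in> A) \<and> card A = m"
  unfolding Sym_def using symmetric_iff by blast

lemma symmetric_Diff:
  assumes "B \<subseteq> carrier G" "\<forall>x\<in>B. \<ominus> x \<in> B" "A \<subseteq> B" "\<forall>x\<in>A. \<ominus> x \<in> A" "x \<in> B - A"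
  shows "\<ominus> x \<in> B - A"
proof -
  have x: "x \<in> B" "x \<notin> A" "\<ominus> (\<ominus> x) = x" using assms by auto
  then have "\<ominus> x \<notin> A" using assms(4) by metis
  then show ?thesis using x assms(2) by blast
qed

lemma Sym_remove_zero:
  assumes "A \<in> Sym G (Suc m)" "\<zero> \<in> A"
  shows "A - {\<zero>} \<in> Sym G m"
proof -
  have A: "A \<subseteq> carrier G" "\<forall>x\<in>A. \<ominus> x \<in> A" "card A = Suc m"
    using assms(1) unfolding Sym_iff by simp_all
  have "\<ominus> x \<in> A - {\<zero>}" if "x \<in> A - {\<zero>}" for x
    using symmetric_Diff[OF A(1,2), of "{\<zero>}" x] assms(2) that by simp
  then show ?thesis using A assms(2) unfolding Sym_iff by auto
qed

text \<open>
  Adding elements two at a time keeps the size odd, so \<open>0\<close> never has to be removed: when a new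
  \<open>x\<close> is its own negative, there is room for a second new element \<open>y\<close>, and either \<open>{x, y}\<close> or
  \<open>{y, -y}\<close> is symmetric.
\<close>

lemma odd_symmetric_subset_exists:
  assumes B: "finite B" "B \<subseteq> carrier G" "\<forall>x\<in>B. \<ominus> x \<in> B" "\<zero> \<in> B"
    and "2 * k + 1 \<le> card B"
  shows "\<exists>A \<in> Sym G (2 * k + 1). A \<subseteq> B \<and> \<zero> \<in> A"
  using assms(5)
proof (induction k)
  case 0
  show ?case using B by (intro bexI[of _ "{\<zero>}"]) (auto simp: Sym_iff)
next
  case (Suc k)
  then have "\<exists>A\<in>Sym G (2 * k + 1). A \<subseteq> B \<and> \<zero> \<in> A" by simp
  then obtain A where "A \<in> Sym G (2 * k + 1)" "A \<subseteq> B" "\<zero> \<in> A" by blast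
  then have A: "A \<subseteq> B" "\<zero> \<in> A" "\<forall>x\<in>A. \<ominus> x \<in> A" "card A = 2 * k + 1"
    unfolding Sym_iff by simp_all
  have fA: "finite A" using A(1) B(1) finite_subset by blast
  have new: "\<ominus> x \<in> B - A" if "x \<in> B - A" for x
    using symmetric_Diff[OF B(2,3) A(1,3) that] .
  have ext: ?case if "x \<in> B - A" "y \<in> B - A" "x \<noteq> y" "\<ominus> x \<in> {x, y}" "\<ominus> y \<in> {x, y}" for x y
  proof (intro bexI[of _ "insert x (insert y A)"])
    show "insert x (insert y A) \<in> Sym G (2 * Suc k + 1)"
      using that A B fA by (auto simp: Sym_iff)
  qed (use that A in auto)
  have "card (B - A) \<ge> 2" using Suc.prems A fA by (simp add: card_Diff_subset)
  then obtain x y where xy: "x \<in> B - A" "y \<in> B - A" "x \<noteq> y"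
    by (metis One_nat_def Suc_1 card_le_Suc0_iff_eq B(1) finite_Diff not_less_eq_eq)
  have car: "x \<in> carrier G" "y \<in> carrier G" using xy B by auto
  consider "\<ominus> x \<noteq> x" | "\<ominus> y \<noteq> y" | "\<ominus> x = x" "\<ominus> y = y" by blast
  then show ?case
  proof cases
    case 1 then show ?thesis using ext[of x "\<ominus> x"] new[of x] xy car by auto
  next
    case 2 then show ?thesis using ext[of y "\<ominus> y"] new[of y] xy car by auto
  next
    case 3 then show ?thesis using ext[of x y] xy by auto
  qed
qed

text \<open>
  For even \<open>m\<close>, an odd symmetric set of size \<open>m - 1\<close> leaves room for at least one element \<open>x\<close> of
  \<open>B\<close>. Both the construction of even symmetric sets and the count in groups of odd order start
  here and differ in what they do with \<open>x\<close> and \<open>-x\<close>.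
\<close>

lemma odd_symmetric_subset_with_spare_element:
  assumes B: "finite B" "B \<subseteq> carrier G" "\<forall>x\<in>B. \<ominus> x \<in> B" "\<zero> \<in> B"
    and m: "m \<le> card B" "even m" "m > 0"
  obtains A x where "A \<in> Sym G (m - 1)" "A \<subseteq> B" "\<zero> \<in> A" "finite A" "x \<in> B - A" "\<ominus> x \<in> B - A"
proof -
  obtain j where j: "m = 2 * j" using m(2) by blast
  then have k: "2 * (j - 1) + 1 = m - 1" using m(3) by simp
  have "2 * (j - 1) + 1 \<le> card B" using k m(1) by simp
  then obtain A where S: "A \<in> Sym G (m - 1)" and A: "A \<subseteq> B" "\<zero> \<in> A"
    using odd_symmetric_subset_exists[OF B, of "j - 1"] unfolding k by blast
  have sym: "\<forall>x\<in>A. \<ominus> x \<in> A" and "card A = m - 1" using S unfolding Sym_iff by simp_all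
  then have "A \<noteq> B" using m by auto
  then obtain x where x: "x \<in> B - A" using A(1) by blast
  show ?thesis
    by (rule that[OF S A finite_subset[OF A(1) B(1)] x symmetric_Diff[OF B(2,3) A(1) sym x]])
qed

text \<open>
  For even \<open>m\<close>, one more element is missing from a set of size \<open>m - 1\<close>: a spare \<open>x = -x\<close> fills
  the gap, and otherwise the pair \<open>{x, -x}\<close> does so when it replaces \<open>0\<close>.
\<close>

lemma symmetric_subset_exists:
  assumes B: "finite B" "B \<subseteq> carrier G" "\<forall>x\<in>B. \<ominus> x \<in> B" "\<zero> \<in> B"
    and m: "m \<le> card B" "m > 0"
  shows "\<exists>A \<in> Sym G m. A \<subseteq> B"
proof (cases "odd m")
  case True
  then obtain k where "m = 2 * k + 1" by (rule oddE)
  then show ?thesis using odd_symmetric_subset_exists[OF B, of k] m(1) by blast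
next
  case False
  then obtain A x where S: "A \<in> Sym G (m - 1)"
    and A: "A \<subseteq> B" "\<zero> \<in> A" "finite A" "x \<in> B - A" "\<ominus> x \<in> B - A"
    using odd_symmetric_subset_with_spare_element[OF B m(1) _ m(2)] by (metis (no_types))
  have x: "x \<in> carrier G" using A(4) B(2) by blast
  show ?thesis
  proof (cases "\<ominus> x = x")
    case True
    then have "insert x A \<in> Sym G m" using S A x m(2) unfolding Sym_iff by auto
    then show ?thesis using A by blast
  next
    case False
    have "card A > 0" using A(2,3) by (auto simp: card_gt_0_iff)
    then have S': "A \<in> Sym G (Suc (m - 2))" and m2: "m = Suc (Suc (m - 2))"
      using S unfolding Sym_iff by auto
    have "card (insert x (insert (\<ominus> x) (A - {\<zero>}))) = Suc (Suc (m - 2))"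
      using Sym_remove_zero[OF S' A(2)] A False unfolding Sym_iff by simp
    then have "insert x (insert (\<ominus> x) (A - {\<zero>})) \<in> Sym G m"
      using Sym_remove_zero[OF S' A(2)] x m2 unfolding Sym_iff by auto
    moreover have "insert x (insert (\<ominus> x) (A - {\<zero>})) \<subseteq> B" using A by auto
    ultimately show ?thesis by (rule bexI[rotated])
  qed
qed

text \<open>
  An element with \<open>-x = x\<close> satisfies \<open>2x = 0\<close>, and also \<open>|G| x = 0\<close> with \<open>|G|\<close> odd.
\<close>

lemma odd_order_no_involution:
  assumes "finite (carrier G)" "odd (card (carrier G))" "x \<in> carrier G" "\<ominus> x = x"
  shows "x = \<zero>"
proof -
  obtain k where k: "card (carrier G) = 2 * k + 1" using assms(2) by (rule oddE)
  have sq: "x [^]\<^bsub>add_monoid G\<^esub> (2::nat) = \<zero>"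
    using assms r_neg[of x] by (simp add: numeral_2_eq_2)
  have "\<zero> = x [^]\<^bsub>add_monoid G\<^esub> (2 * k + 1)"
    using group.pow_order_eq_1[OF a_group, of x] assms(3) k by (simp add: order_def)
  also have "\<dots> = (x [^]\<^bsub>add_monoid G\<^esub> (2::nat)) [^]\<^bsub>add_monoid G\<^esub> k \<oplus> x"
    using monoid.nat_pow_pow[OF a_monoid, of x 2 k] assms(3) by simp
  also have "\<dots> = x"
    using monoid.nat_pow_one[OF a_monoid, of k] assms(3) by (simp add: sq)
  finally show ?thesis by simp
qed

text \<open>
  In odd order, a symmetric set through \<open>0\<close> has odd size, so that the size \<open>m\<close> can be rounded up
  to the next odd number \<open>2 (m div 2) + 1\<close>.
\<close>

lemma odd_order_symmetric_card_ge:
  assumes "finite (carrier G)" "odd (card (carrier G))"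
    and B: "B \<subseteq> carrier G" "\<forall>x\<in>B. \<ominus> x \<in> B" "\<zero> \<in> B"
    and m: "m \<le> card B"
  shows "2 * (m div 2) + 1 \<le> card B"
proof (cases "even m \<and> m > 0")
  case True
  have fB: "finite B" using B(1) assms(1) finite_subset by blast
  obtain A x where S: "A \<in> Sym G (m - 1)"
    and A: "A \<subseteq> B" "\<zero> \<in> A" "finite A" "x \<in> B - A" "\<ominus> x \<in> B - A"
    using odd_symmetric_subset_with_spare_element[OF fB B m] True by blast
  have "x \<in> carrier G" "x \<noteq> \<zero>" using A B(1) by auto
  then have "\<ominus> x \<noteq> x" using odd_order_no_involution[OF assms(1,2)] by blast
  then have "card (insert x (insert (\<ominus> x) A)) = m + 1"
    using S A True unfolding Sym_iff by simp
  moreover have "card (insert x (insert (\<ominus> x) A)) \<le> card B"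
    using A fB by (intro card_mono) auto
  ultimately show ?thesis using True by simp
next
  case False
  have "finite B" using B assms(1) finite_subset by blast
  then have "card B \<ge> 1" using B by (auto simp: Suc_le_eq card_gt_0_iff)
  then show ?thesis using False m by (auto elim!: oddE)
qed

section \<open>Comparison of the minima\<close>

lemma signed_sumset_upto_Sym:
  assumes "finite A" "A \<in> Sym G m"
  shows "signed_sumset_upto G h A = sumset G h (A \<union> {\<zero>})"
  using signed_sumset_upto_eq_sumset[OF assms(1)] assms(2) by (auto simp: Sym_def)

text \<open>
  Any symmetric set found inside \<open>B = A \<union> -A \<union> {0}\<close> does at least as well as \<open>A\<close>, because
  \<open>[0,h]\<^sub>\<plusminus>A\<close> is all of \<open>hB\<close>.
\<close>

lemma symmetric_hull:
  assumes A: "finite A" "A \<subseteq> carrier G"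
  obtains B where "finite B" "B \<subseteq> carrier G" "\<forall>x\<in>B. \<ominus> x \<in> B" "\<zero> \<in> B"
    "card A \<le> card B" "\<forall>C\<subseteq>B. card (sumset G h C) \<le> card (signed_sumset_upto G h A)"
proof
  let ?B = "A \<union> a_inv G ` A \<union> {\<zero>}"
  show B: "finite ?B" "?B \<subseteq> carrier G" using A by auto
  show "\<forall>x\<in>?B. \<ominus> x \<in> ?B" using A by (auto simp: subset_iff)
  show "card A \<le> card ?B" using B by (intro card_mono) auto
  show "\<forall>C\<subseteq>?B. card (sumset G h C) \<le> card (signed_sumset_upto G h A)"
    unfolding signed_sumset_upto_eq_sumset[OF A]
    using card_mono[OF finite_sumset[OF B] sumset_mono[OF B(1) _ B(2)]] by blast
qed simp

end

text \<open>
  Domination in both directions gives equality of the minima. Nonemptiness of one family carries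
  over to the other, so neither side is the meaningless infimum of the empty set.
\<close>

lemma INF_nat_eqI:
  fixes f :: "'c \<Rightarrow> nat" and g :: "'d \<Rightarrow> nat"
  assumes "S \<noteq> {}"
    and "\<And>x. x \<in> S \<Longrightarrow> \<exists>y\<in>T. g y \<le> f x" and "\<And>y. y \<in> T \<Longrightarrow> \<exists>x\<in>S. f x \<le> g y"
  shows "(INF x\<in>S. f x) = (INF y\<in>T. g y)"
proof (rule antisym)
  have "T \<noteq> {}" using assms by blast
  then show "(INF x\<in>S. f x) \<le> (INF y\<in>T. g y)"
    using assms(3) by (intro cINF_greatest) (auto intro: cINF_lower2)
  show "(INF y\<in>T. g y) \<le> (INF x\<in>S. f x)"
    using assms(1,2) by (intro cINF_greatest) (auto intro: cINF_lower2)
qed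

theorem theorem3p4:
  fixes G :: "('a, 'b) ring_scheme" and h m :: nat
  assumes "abelian_group G"
    and "h \<ge> 1" and "m \<ge> 2"
    and "infinite (carrier G) \<or> m \<le> card (carrier G)"
  shows "rho_signed_upto G m h = (INF A\<in>Sym G m. card (signed_sumset_upto G h A))
    \<and> rho_signed_upto G m h = (INF A\<in>Sym G m. card (sumset G h (A \<union> {\<zero>\<^bsub>G\<^esub>})))
    \<and> (odd m \<longrightarrow>
        rho_signed_upto G m h = (INF A\<in>{A \<in> Sym G m. \<zero>\<^bsub>G\<^esub> \<in> A}. card (sumset G h A)))
    \<and> (finite (carrier G) \<and> odd (card (carrier G)) \<longrightarrow>
        rho_signed_upto G m h =
          (INF A\<in>{A \<in> Sym G (2 * (m div 2) + 1). \<zero>\<^bsub>G\<^esub> \<in> A}. card (sumset G h A)))"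
proof -
  interpret abelian_group G by fact
  let ?S = "{A. A \<subseteq> carrier G \<and> card A = m}"
  let ?O = "\<lambda>k. {A \<in> Sym G k. \<zero>\<^bsub>G\<^esub> \<in> A}"
  have fin: "finite A" if "card A = m" for A :: "'a set"
    using that assms(3) by (intro card_ge_0_finite) simp
  have ne: "?S \<noteq> {}"
    using assms(4) by (metis (mono_tags, lifting) empty_iff infinite_arbitrarily_large mem_Collect_eq
        obtain_subset_with_card_n)
  have Sym: "finite A" "A \<in> ?S" "signed_sumset_upto G h A = sumset G h (A \<union> {\<zero>\<^bsub>G\<^esub>})"
    if "A \<in> Sym G m" for A
  proof -
    show "finite A" "A \<in> ?S" using that fin by (auto simp: Sym_def)
    then show "signed_sumset_upto G h A = sumset G h (A \<union> {\<zero>\<^bsub>G\<^esub>})"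
      using that signed_sumset_upto_Sym by blast
  qed
  have down: "\<exists>A'\<in>Sym G m. card (sumset G h (A' \<union> {\<zero>\<^bsub>G\<^esub>})) \<le> card (signed_sumset_upto G h A)"
    if "A \<in> ?S" for A
  proof -
    have "finite A" "A \<subseteq> carrier G" using that fin by auto
    then obtain B where B: "finite B" "B \<subseteq> carrier G" "\<forall>x\<in>B. \<ominus>\<^bsub>G\<^esub> x \<in> B" "\<zero>\<^bsub>G\<^esub> \<in> B"
        "card A \<le> card B"
        "\<forall>C\<subseteq>B. card (sumset G h C) \<le> card (signed_sumset_upto G h A)"
      using symmetric_hull[of A h] by metis
    have "m \<le> card B" "m > 0" using that B(5) assms(3) by simp_all
    then obtain A' where "A' \<in> Sym G m" "A' \<subseteq> B"
      using symmetric_subset_exists[OF B(1-4)] by blast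
    moreover from this have "A' \<union> {\<zero>\<^bsub>G\<^esub>} \<subseteq> B" using B(4) by blast
    ultimately show ?thesis using B(6) by blast
  qed
  have down_odd: "\<exists>A'\<in>?O (2 * (m div 2) + 1).
      card (sumset G h A') \<le> card (signed_sumset_upto G h A)"
    if "A \<in> ?S" "odd m \<or> finite (carrier G) \<and> odd (card (carrier G))" for A
  proof -
    have "finite A" "A \<subseteq> carrier G" using that fin by auto
    then obtain B where B: "finite B" "B \<subseteq> carrier G" "\<forall>x\<in>B. \<ominus>\<^bsub>G\<^esub> x \<in> B" "\<zero>\<^bsub>G\<^esub> \<in> B"
        "card A \<le> card B"
        "\<forall>C\<subseteq>B. card (sumset G h C) \<le> card (signed_sumset_upto G h A)"
      using symmetric_hull[of A h] by metis
    have "m \<le> card B" using that B(5) by simp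
    then have "2 * (m div 2) + 1 \<le> card B"
      using that(2) odd_order_symmetric_card_ge[OF _ _ B(2-4)] by auto
    then show ?thesis using odd_symmetric_subset_exists[OF B(1-4)] B(6) by blast
  qed
  \<comment> \<open>A symmetric set through \<open>0\<close> of size \<open>m + 1\<close>, with \<open>m\<close> even, is matched by the same set
      without \<open>0\<close>: the set \<open>[0,h]\<^sub>\<plusminus>A\<close> is the same for both.\<close>
  have up_odd: "\<exists>A'\<in>?S. card (signed_sumset_upto G h A') \<le> card (sumset G h A)"
    if "A \<in> ?O (2 * (m div 2) + 1)" for A
  proof (cases "odd m")
    case True
    then have "A \<in> Sym G m" "\<zero>\<^bsub>G\<^esub> \<in> A" using that by simp_all
    then show ?thesis using Sym[of A] by (intro bexI[of _ A]) (auto simp: insert_absorb)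
  next
    case False
    have A: "A \<in> Sym G (Suc m)" "\<zero>\<^bsub>G\<^esub> \<in> A" using that False by auto
    have S: "A - {\<zero>\<^bsub>G\<^esub>} \<in> Sym G m" by (rule Sym_remove_zero[OF A])
    have "A - {\<zero>\<^bsub>G\<^esub>} \<union> {\<zero>\<^bsub>G\<^esub>} = A" using A(2) by auto
    then have "signed_sumset_upto G h (A - {\<zero>\<^bsub>G\<^esub>}) = sumset G h A"
      using Sym(3)[OF S] by simp
    then show ?thesis using Sym(2)[OF S] by (intro bexI[of _ "A - {\<zero>\<^bsub>G\<^esub>}"]) simp_all
  qed
  have 2: "rho_signed_upto G m h = (INF A\<in>Sym G m. card (sumset G h (A \<union> {\<zero>\<^bsub>G\<^esub>})))"
    unfolding rho_signed_upto_def
  proof (rule INF_nat_eqI[OF ne down])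
    fix A assume "A \<in> Sym G m"
    then show "\<exists>A'\<in>?S. card (signed_sumset_upto G h A') \<le> card (sumset G h (A \<union> {\<zero>\<^bsub>G\<^esub>}))"
      using Sym(2,3) by (intro bexI[of _ A]) simp_all
  qed
  have 4: "rho_signed_upto G m h = (INF A\<in>?O (2 * (m div 2) + 1). card (sumset G h A))"
    if "odd m \<or> finite (carrier G) \<and> odd (card (carrier G))"
    unfolding rho_signed_upto_def
    by (rule INF_nat_eqI[OF ne down_odd[OF _ that] up_odd])
  have "(INF A\<in>Sym G m. card (signed_sumset_upto G h A))
      = (INF A\<in>Sym G m. card (sumset G h (A \<union> {\<zero>\<^bsub>G\<^esub>})))"
    using Sym(3) by (intro INF_cong) auto
  moreover have "2 * (m div 2) + 1 = m" if "odd m" using that by simp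
  ultimately show ?thesis using 2 4 by auto
qed

end
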